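(* The collection $\mathcal{QS}=\bigsqcup_{n\geq 1}\mathcal{QS}(n)$, equipped with the products $\circ_i:\mathcal{QS}(n)\times\mathcal{QS}(m)\to\mathcal{QS}(n+m-1)$ ($n,m\ge 1$, $1\le i\le n$) given in the context and with the unit $\mathbf{1}=(0)\in\mathcal{QS}(1)$, is a nonsymmetric SET quiddity-operad.
   Context: Write $[n]=\{1,\ldots,n\}$. Nonsymmetric SET quiddity-operad: a collection of sets $\mathcal{P}=\bigsqcup_{n\geq 1}\mathcal{P}(n)$ together with partial composition maps $\circ_{i}:\mathcal{P}(n)\times \mathcal{P}(m)\to \mathcal{P}(n+m-1)$ for $n,m\geq 1$, $i\in [n]$, and a distinguished element $\mathbf{1}\in \mathcal{P}(1)$ (the unit), such that for all $x\in\mathcal{P}(n)$, $y\in \mathcal{P}(m)$, $z\in\mathcal{P}(k)$: (1) $(x\circ_{i} y)\circ_{i+j-1} z=x\circ_{i}(y\circ_{j}z)$ for $i\in [n]$ and $j\in [m-1]$, where $m\ge 2$; (2) $(x\circ_{i} y)\circ_{j+m-1} z=(x\circ_{j} z)\circ_{i} y$ for $i,j\in [n]$ with $i<j$, where $n>1$; (3) $\mathbf{1}\circ_{1} x=x=x\circ_{i} \mathbf{1}$ for all $i\in[n]$. (In (1), the case $j=m$ is deliberately excluded.) The sets: for $n\ge 3$, consider a plane convex $n$-gon with vertices labeled counterclockwise by $1,\ldots,n$; the quiddity sequence of a triangulation is $(t_1,\ldots,t_n)$, where $t_i$ is the number of triangles incident with vertex $i$, and $\mathcal{QS}(n)$ is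 the set of all quiddity sequences of triangulations of the $n$-gon. Moreover $\mathcal{QS}(1)=\{(0)\}$ and $\mathcal{QS}(2)=\{(0,0)\}$. The products: (a) for $n,m\ge 3$, $\mathcal{T}=(t_1,\ldots,t_n)\in\mathcal{QS}(n)$, $\mathcal{S}=(s_1,\ldots,s_m)\in\mathcal{QS}(m)$: for $1\le i\le n-1$, $$\mathcal{T}\circ_{i}\mathcal{S}=(t_{1},\ldots,t_{i-1}, t_{i}+s_{1}+1,s_{2},\ldots,s_{m-1}, s_{m}+1, t_{i+1}+1,t_{i+2},\ldots,t_{n}),$$ and $\mathcal{T}\circ_{n}\mathcal{S}=(t_{1}+1,t_{2},\ldots,t_{n-1}, t_{n}+s_{1}+1,s_{2},\ldots,s_{m-1}, s_{m}+1)$; (b) for $n\geq 1$ and $i\in[n]$: $(0)\circ_{1}(t_{1},\ldots,t_{n})=(t_{1},\ldots,t_{n})\circ_{i}(0)=(t_{1},\ldots,t_{n})$; (c) for $n\ge 3$: $(t_{1},\ldots,t_{n})\circ_{i}(0,0)=(t_{1},\ldots,t_{i-1},t_{i}+1,1,t_{i+1}+1,t_{i+2},\ldots,t_{n})$ for $1\le i\le n-1$, and $(t_{1},\ldots,t_{n})\circ_{n}(0,0)=(t_{1}+1,t_{2},\ldots,t_{n-1},t_{n}+1,1)$; (d) for $n\ge 3$: $(0,0)\circ_{1}(t_{1},\ldots,t_{n})=(t_{1}+1,t_{2},\ldots,t_{n-1},t_{n}+1,1)$ and $(0,0)\circ_{2}(t_{1},\ldots,t_{n})=(1,t_{1}+1,t_{2},\ldots,t_{n-1},t_{n}+1)$;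 (e) $(0,0)\circ_{1}(0,0)=(0,0)\circ_{2}(0,0)=(1,1,1)$. *)

theory Defs
  imports "HOL-Analysis.Analysis"
begin

section \<open>Nonsymmetric SET quiddity-operads\<close>

text \<open>Compositions are indexed from 1. The sets \<open>P n\<close> are only relevant for \<open>n \<ge> 1\<close>; being
  pairwise disjoint, they determine the arity of an element, so the composition needs no arity
  arguments. In \<open>assoc\<close> the index \<open>j = m\<close> is deliberately excluded: this is the difference from
  an ordinary nonsymmetric operad.\<close>

locale quiddity_operad =
  fixes P :: "nat \<Rightarrow> 'a set"
    and pcomp :: "nat \<Rightarrow> 'a \<Rightarrow> 'a \<Rightarrow> 'a"
    and unit :: 'a
  assumes disjoint: "\<lbrakk>1 \<le> n; 1 \<le> m; n \<noteq> m\<rbrakk> \<Longrightarrow> P n \<inter> P m = {}"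
    and pcomp_closed: "\<lbrakk>1 \<le> n; 1 \<le> m; i \<in> {1..n}; x \<in> P n; y \<in> P m\<rbrakk>
          \<Longrightarrow> pcomp i x y \<in> P (n + m - 1)"
    and unit_closed: "unit \<in> P 1"
    and assoc: "\<lbrakk>1 \<le> n; 2 \<le> m; 1 \<le> k; x \<in> P n; y \<in> P m; z \<in> P k; i \<in> {1..n}; j \<in> {1..m - 1}\<rbrakk>
          \<Longrightarrow> pcomp (i + j - 1) (pcomp i x y) z = pcomp i x (pcomp j y z)"
    and commute: "\<lbrakk>1 < n; 1 \<le> m; 1 \<le> k; x \<in> P n; y \<in> P m; z \<in> P k;
            i \<in> {1..n}; j \<in> {1..n}; i < j\<rbrakk>
          \<Longrightarrow> pcomp (j + m - 1) (pcomp i x y) z = pcomp i (pcomp j x z) y"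
    and unit_left: "\<lbrakk>1 \<le> n; x \<in> P n\<rbrakk> \<Longrightarrow> pcomp 1 unit x = x"
    and unit_right: "\<lbrakk>1 \<le> n; x \<in> P n; i \<in> {1..n}\<rbrakk> \<Longrightarrow> pcomp i x unit = x"

section \<open>Triangulations of convex polygons and quiddity sequences\<close>

definition ccw :: "complex \<Rightarrow> complex \<Rightarrow> complex \<Rightarrow> bool" where
  "ccw a b c \<longleftrightarrow> Im (cnj (b - a) * (c - a)) > 0"

text \<open>The points \<open>p 1, \<dots>, p n\<close> are, in counterclockwise order, the vertices of a (strictly) convex
  polygon if and only if all triples with increasing labels are positively oriented.\<close>

definition convex_ngon :: "nat \<Rightarrow> (nat \<Rightarrow> complex) \<Rightarrow> bool" where
  "convex_ngon n p \<longleftrightarrow> 3 \<le> n \<and>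
     (\<forall>i j k. 1 \<le> i \<and> i < j \<and> j < k \<and> k \<le> n \<longrightarrow> ccw (p i) (p j) (p k))"

text \<open>Sides and diagonals are represented by the two-element sets of labels of their endpoints.\<close>

definition sides :: "nat \<Rightarrow> nat set set" where
  "sides n = {{i, i + 1} | i. 1 \<le> i \<and> i < n} \<union> {{n, 1}}"

definition diagonals :: "nat \<Rightarrow> nat set set" where
  "diagonals n = {{i, j} | i j. i \<in> {1..n} \<and> j \<in> {1..n} \<and> i \<noteq> j} - sides n"

text \<open>Two diagonals cross if they meet in a point that is an endpoint of neither.
  Diagonals that only share a vertex do not cross.\<close>

definition crossing :: "(nat \<Rightarrow> complex) \<Rightarrow> nat set \<Rightarrow> nat set \<Rightarrow> bool" where
  "crossing p d e \<longleftrightarrow> (\<exists>a b a' b'. d = {a, b} \<and> e = {a', b'} \<and>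
     open_segment (p a) (p b) \<inter> open_segment (p a') (p b') \<noteq> {})"

text \<open>A triangulation is given by a maximal set of pairwise noncrossing diagonals.\<close>

definition triangulation :: "nat \<Rightarrow> (nat \<Rightarrow> complex) \<Rightarrow> nat set set \<Rightarrow> bool" where
  "triangulation n p D \<longleftrightarrow> D \<subseteq> diagonals n \<and>
     (\<forall>d\<in>D. \<forall>e\<in>D. d \<noteq> e \<longrightarrow> \<not> crossing p d e) \<and>
     (\<forall>d\<in>diagonals n. (\<forall>e\<in>D. \<not> crossing p d e) \<longrightarrow> d \<in> D)"

text \<open>The triangles of a triangulation. As the polygon is convex, no vertex and no diagonal of the
  triangulation meets the interior of a triangle bounded by sides and diagonals of the
  triangulation, so every such triangle is one of the pieces.\<close>

definition triangles :: "nat \<Rightarrow> nat set set \<Rightarrow> nat set set" where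
  "triangles n D = {t. t \<subseteq> {1..n} \<and> card t = 3 \<and>
     (\<forall>i\<in>t. \<forall>j\<in>t. i \<noteq> j \<longrightarrow> {i, j} \<in> sides n \<union> D)}"

definition quiddity :: "nat \<Rightarrow> nat set set \<Rightarrow> nat list" where
  "quiddity n D = map (\<lambda>i. card {t \<in> triangles n D. i \<in> t}) [1..<n + 1]"

definition QS :: "nat \<Rightarrow> nat list set" where
  "QS n = (if n = 1 then {[0]}
           else if n = 2 then {[0, 0]}
           else {quiddity n D | p D. convex_ngon n p \<and> triangulation n p D})"

section \<open>The partial compositions of quiddity sequences\<close>

text \<open>List positions start at 0, so \<open>t\<^sub>i\<close> is \<open>T ! (i - 1)\<close>; \<open>butlast (tl S)\<close> is
  \<open>s\<^sub>2, \<dots>, s\<^bsub>m-1\<^esub>\<close>. \<open>[0]\<close> and \<open>[0, 0]\<close> are the only elements of \<open>QS 1\<close> and \<open>QS 2\<close>, so the last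
  case is the one of arities at least 3.\<close>

definition qcomp :: "nat \<Rightarrow> nat list \<Rightarrow> nat list \<Rightarrow> nat list" where
  "qcomp i T S =
    (if T = [0] then S
     else if S = [0] then T
     else if T = [0, 0] \<and> S = [0, 0] then [1, 1, 1]
     else if T = [0, 0] then
       (if i = 1 then [hd S + 1] @ butlast (tl S) @ [last S + 1, 1]
        else [1, hd S + 1] @ butlast (tl S) @ [last S + 1])
     else if S = [0, 0] then
       (if i < length T then take (i - 1) T @ [T ! (i - 1) + 1, 1, T ! i + 1] @ drop (i + 1) T
        else [hd T + 1] @ butlast (tl T) @ [last T + 1, 1])
     else
       (if i < length T then
          take (i - 1) T @ [T ! (i - 1) + hd S + 1] @ butlast (tl S) @
          [last S + 1, T ! i + 1] @ drop (i + 1) T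
        else
          [hd T + 1] @ butlast (tl T) @ [last T + hd S + 1] @ butlast (tl S) @ [last S + 1]))"

end

theory Submission
  imports Defs
begin

text \<open>Whether two diagonals of a convex polygon cross depends only on whether their endpoints
  interleave, so quiddity sequences are a combinatorial matter. Composing with \<open>(0, 0)\<close> attaches an
  ear, and every triangulation arises from the 2-gon by attaching ears at sides other than the one
  from the last to the first vertex. Thus every \<open>S\<close> of length at least 3 is \<open>S' \<circ>\<^sub>j (0, 0)\<close> with
  \<open>j\<close> less than the arity of \<open>S'\<close>, and closure under composition follows by induction from
  \<open>T \<circ>\<^sub>i (S' \<circ>\<^sub>j (0, 0)) = (T \<circ>\<^sub>i S') \<circ>\<^bsub>i+j-1\<^esub> (0, 0)\<close>. The operad laws themselves hold
  for arbitrary lists of length at least 2.\<close>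

section \<open>Crossing diagonals of a convex polygon\<close>

text \<open>The choice of endpoint names in \<open>crossing\<close> is harmless, as an open segment
  does not depend on the order of its ends.\<close>

lemma crossing_doubleton_iff:
  "crossing p {a, b} {c, d} \<longleftrightarrow> open_segment (p a) (p b) \<inter> open_segment (p c) (p d) \<noteq> {}"
  by (fastforce simp: crossing_def doubleton_eq_iff open_segment_commute)

lemma ccw_rotate: "ccw a b c \<longleftrightarrow> ccw b c a"
  by (simp add: ccw_def algebra_simps)

lemma ccw_swap: "ccw a b c \<Longrightarrow> Im (cnj (c - a) * (b - a)) < 0"
  by (simp add: ccw_def algebra_simps)

text \<open>\<open>Im (cnj (b - a) * (x - a))\<close> is twice the signed area of the triangle
  \<open>a b x\<close>, hence affine in \<open>x\<close>.\<close>

lemma side_affine: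
  fixes a b c d :: complex
  shows "Im (cnj (b - a) * ((1 - u) *\<^sub>R c + u *\<^sub>R d - a)) =
    (1 - u) * Im (cnj (b - a) * (c - a)) + u * Im (cnj (b - a) * (d - a))"
  by (simp add: algebra_simps)

text \<open>The signed area over the base \<open>a b\<close> vanishes along that segment. At an
  inner point of the other segment it is a mean with positive weights of two values that do not have
  opposite signs and are not both 0.\<close>

lemma open_segments_disjoint:
  fixes a b c d :: complex
  assumes "Im (cnj (b - a) * (c - a)) * Im (cnj (b - a) * (d - a)) \<ge> 0"
    and "Im (cnj (b - a) * (c - a)) \<noteq> 0 \<or> Im (cnj (b - a) * (d - a)) \<noteq> 0"
  shows "open_segment a b \<inter> open_segment c d = {}"
proof (rule ccontr)
  assume "open_segment a b \<inter> open_segment c d \<noteq> {}"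
  then obtain u v where u: "0 < u" "u < 1" and v: "0 < v" "v < (1::real)"
    and eq: "(1 - u) *\<^sub>R a + u *\<^sub>R b = (1 - v) *\<^sub>R c + v *\<^sub>R d"
    by (auto simp: in_segment)
  let ?C = "Im (cnj (b - a) * (c - a))" and ?D = "Im (cnj (b - a) * (d - a))"
  have "(1 - v) * ?C + v * ?D = (1 - u) * Im (cnj (b - a) * (a - a)) + u * Im (cnj (b - a) * (b - a))"
    using side_affine[of b a v c d] side_affine[of b a u a b] eq by simp
  also have "\<dots> = 0"
    by (simp add: algebra_simps)
  finally have "(1 - v) * ?C + v * ?D = 0" .
  moreover have "(1 - v) * ?C + v * ?D \<noteq> 0"
  proof (cases "?C \<ge> 0 \<and> ?D \<ge> 0")
    case True
    then show ?thesis
      using assms(2) u v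
      by (metis add_nonneg_eq_0_iff diff_gt_0_iff_gt less_eq_real_def mult_eq_0_iff mult_nonneg_nonneg
          less_numeral_extra(3))
  next
    case False
    then have "- ?C \<ge> 0 \<and> - ?D \<ge> 0"
      using assms(1) by (auto simp: zero_le_mult_iff)
    then have "(1 - v) * - ?C + v * - ?D \<noteq> 0"
      using assms(2) u v
      by (metis add_nonneg_eq_0_iff diff_gt_0_iff_gt less_eq_real_def mult_eq_0_iff mult_nonneg_nonneg
          less_numeral_extra(3) neg_equal_0_iff_equal)
    then show ?thesis
      by (simp only: mult_minus_right)
  qed
  ultimately show False
    by contradiction
qed

text \<open>The quadrilateral \<open>a c b d\<close> is convex, and the parameters of the
  intersection of its diagonals are ratios of areas.\<close>

lemma open_segments_meet:
  fixes a b c d :: complex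
  assumes "ccw a c b" "ccw a b d" "ccw a c d" "ccw c b d"
  shows "open_segment a b \<inter> open_segment c d \<noteq> {}"
proof -
  define A where "A = Im (cnj (c - a) * (b - a))"
  define B where "B = Im (cnj (b - a) * (d - a))"
  define C where "C = Im (cnj (c - a) * (d - a))"
  define D where "D = Im (cnj (b - c) * (d - c))"
  have pos: "A > 0" "B > 0" "C > 0" "D > 0"
    using assms by (auto simp: ccw_def A_def B_def C_def D_def)
  \<comment> \<open>Either diagonal cuts the quadrilateral into two triangles, and both sides are
    twice its area.\<close>
  have sum: "A + B = C + D"
    by (simp add: A_def B_def C_def D_def algebra_simps)
  define u where "u = C / (A + B)"
  define v where "v = A / (A + B)"
  have uv: "0 < u" "u < 1" "0 < v" "v < 1"
    using pos sum by (auto simp: u_def v_def)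
  have scaled: "(A + B) *\<^sub>R a + C *\<^sub>R (b - a) = (A + B) *\<^sub>R c + A *\<^sub>R (d - c)"
    by (simp add: A_def B_def C_def complex_eq_iff algebra_simps)
  have "(1 - u) *\<^sub>R a + u *\<^sub>R b = (1 / (A + B)) *\<^sub>R ((A + B) *\<^sub>R a + C *\<^sub>R (b - a))"
    using pos by (simp add: u_def scaleR_add_right scaleR_diff_right scaleR_diff_left)
  moreover have "(1 - v) *\<^sub>R c + v *\<^sub>R d = (1 / (A + B)) *\<^sub>R ((A + B) *\<^sub>R c + A *\<^sub>R (d - c))"
    using pos by (simp add: v_def scaleR_add_right scaleR_diff_right scaleR_diff_left)
  ultimately have eq: "(1 - u) *\<^sub>R a + u *\<^sub>R b = (1 - v) *\<^sub>R c + v *\<^sub>R d"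
    using scaled by simp
  have ne: "a \<noteq> b" "c \<noteq> d"
    using assms by (auto simp: ccw_def)
  have "(1 - u) *\<^sub>R a + u *\<^sub>R b \<in> open_segment a b"
    using uv ne by (auto simp: in_segment)
  moreover have "(1 - u) *\<^sub>R a + u *\<^sub>R b \<in> open_segment c d"
    unfolding eq using uv ne by (auto simp: in_segment)
  ultimately show ?thesis
    by blast
qed

lemma crossing_iff:
  assumes p: "convex_ngon n p" and ab: "1 \<le> a" "a < b" "b \<le> n" and cd: "1 \<le> c" "c < d" "d \<le> n"
    and ne: "a \<noteq> c \<or> b \<noteq> d"
  shows "crossing p {a, b} {c, d} \<longleftrightarrow> a < c \<and> c < b \<and> b < d \<or> c < a \<and> a < d \<and> d < b"
proof -
  have conv: "ccw (p i) (p j) (p k)" if "1 \<le> i" "i < j" "j < k" "k \<le> n" for i j k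
    using p that by (auto simp: convex_ngon_def)
  let ?s = "\<lambda>x. Im (cnj (p b - p a) * (p x - p a))"
  have inside: "?s x < 0" if "a < x" "x < b" for x
    using ccw_swap[OF conv[of a x b]] that ab by simp
  have outside: "?s x > 0" if "1 \<le> x" "x \<le> n" "x < a \<or> b < x" for x
    using conv[of a b x] conv[of x a b] ccw_rotate[of "p x" "p a" "p b"] that ab by (auto simp: ccw_def)
  have ends: "?s a = 0" "?s b = 0"
    by (simp_all add: algebra_simps)
  \<comment> \<open>Labels that do not interleave lie both within the closed range from
    \<open>a\<close> to \<open>b\<close> or both outside its interior. Then \<open>?s\<close> has no
    sign change, and \<open>ne\<close> prevents both values from being 0.\<close>
  consider (cross1) "a < c" "c < b" "b < d" | (cross2) "c < a" "a < d" "d < b"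
    | (inner) "a \<le> c" "d \<le> b" | (outer) "c \<le> a \<or> b \<le> c" "d \<le> a \<or> b \<le> d"
    using cd by linarith
  then show ?thesis
  proof cases
    case cross1
    then have "open_segment (p a) (p b) \<inter> open_segment (p c) (p d) \<noteq> {}"
      using ab cd by (intro open_segments_meet conv) auto
    then show ?thesis
      using cross1 by (simp add: crossing_doubleton_iff)
  next
    case cross2
    then have "open_segment (p c) (p d) \<inter> open_segment (p a) (p b) \<noteq> {}"
      using ab cd by (intro open_segments_meet conv) auto
    then show ?thesis
      using cross2 by (simp add: crossing_doubleton_iff Int_commute)
  next
    case inner
    have le: "?s c \<le> 0" "?s d \<le> 0"
      using inside[of c] inside[of d] ends inner cd by (metis le_less le_less_trans less_le_trans)+
    moreover have "?s c \<noteq> 0 \<or> ?s d \<noteq> 0"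
      using inside[of c] inside[of d] inner cd ne by (metis le_less le_less_trans less_irrefl less_le_trans)
    ultimately have "open_segment (p a) (p b) \<inter> open_segment (p c) (p d) = {}"
      by (intro open_segments_disjoint mult_nonpos_nonpos)
    then show ?thesis
      using inner by (auto simp: crossing_doubleton_iff)
  next
    case outer
    have le: "?s c \<ge> 0" "?s d \<ge> 0"
      using outside[of c] outside[of d] ends outer cd ab
      by (metis le_less less_imp_le_nat order_trans)+
    moreover have "?s c \<noteq> 0 \<or> ?s d \<noteq> 0"
    proof -
      have "c < a \<or> b < c \<or> d < a \<or> b < d"
        using outer cd ab ne by linarith
      then show ?thesis
        using outside[of c] outside[of d] cd by fastforce
    qed
    ultimately have "open_segment (p a) (p b) \<inter> open_segment (p c) (p d) = {}"
      by (intro open_segments_disjoint mult_nonneg_nonneg)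
    then show ?thesis
      using outer by (auto simp: crossing_doubleton_iff)
  qed
qed

text \<open>On a parabola the orientation of three points is a Vandermonde product. This supplies a
  polygon for each \<open>n\<close>.\<close>

lemma convex_ngon_parabola:
  assumes "3 \<le> n"
  shows "convex_ngon n (\<lambda>k. Complex (real k) ((real k)\<^sup>2))"
  unfolding convex_ngon_def ccw_def
proof (intro conjI allI impI assms)
  fix i j k :: nat
  assume "1 \<le> i \<and> i < j \<and> j < k \<and> k \<le> n"
  then have "0 < (real j - real i) * (real k - real i) * (real k - real j)"
    by simp
  also have "\<dots> = Im (cnj (Complex (real j) ((real j)\<^sup>2) - Complex (real i) ((real i)\<^sup>2)) *
      (Complex (real k) ((real k)\<^sup>2) - Complex (real i) ((real i)\<^sup>2)))"
    by (simp add: algebra_simps power2_eq_square)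
  finally show "0 < Im (cnj (Complex (real j) ((real j)\<^sup>2) - Complex (real i) ((real i)\<^sup>2)) *
      (Complex (real k) ((real k)\<^sup>2) - Complex (real i) ((real i)\<^sup>2)))" .
qed

section \<open>Algebra of the compositions\<close>

text \<open>For lists of length at least 2, the rules of \<open>qcomp\<close> for
  \<open>[0, 0]\<close> are instances of the general ones, so only inner and wrap-around insertion
  remain.\<close>

lemma qcomp_inner:
  assumes "2 \<le> length T" "2 \<le> length S" "1 \<le> i" "i < length T"
  shows "qcomp i T S = take (i - 1) T @ [T ! (i - 1) + hd S + 1] @ butlast (tl S) @
          [last S + 1, T ! i + 1] @ drop (i + 1) T"
  using assms by (auto simp: qcomp_def)

lemma qcomp_outer:
  assumes "2 \<le> length T" "2 \<le> length S" "i = length T"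
  shows "qcomp i T S = [hd T + 1] @ butlast (tl T) @ [last T + hd S + 1] @ butlast (tl S) @ [last S + 1]"
  using assms by (auto simp: qcomp_def)

lemma length_qcomp:
  assumes "2 \<le> length T" "2 \<le> length S" "1 \<le> i" "i \<le> length T"
  shows "length (qcomp i T S) = length T + length S - 1"
  using assms by (cases "i = length T") (auto simp: qcomp_inner qcomp_outer)

text \<open>The block that replaces an entry \<open>a\<close> when \<open>S\<close> is inserted
  there, common to inner and wrap-around insertion.\<close>

definition glue :: "nat \<Rightarrow> nat list \<Rightarrow> nat list" where
  "glue a S = (a + hd S + 1) # butlast (tl S) @ [last S + 1]"

lemma glue_simp [simp]: "glue a (s # M @ [s']) = (a + s + 1) # M @ [s' + 1]"
  by (simp add: glue_def)

lemma ends_cases: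
  assumes "2 \<le> length S"
  obtains s M s' where "S = s # M @ [s']"
  using assms by (cases S rule: rev_cases; cases "butlast S"; fastforce)

lemma adjacent_cases:
  assumes "1 \<le> i" "i < length T"
  obtains A a b B where "T = A @ a # b # B" "i = Suc (length A)"
proof
  show "T = take (i - 1) T @ T ! (i - 1) # T ! i # drop (i + 1) T"
    using assms by (metis Cons_nth_drop_Suc Suc_diff_1 Suc_eq_plus1 Suc_lessD append_take_drop_id
        less_le_trans zero_less_one)
  show "i = Suc (length (take (i - 1) T))"
    using assms by simp
qed

lemma qcomp_append:
  assumes "2 \<le> length S"
  shows "qcomp (Suc (length A)) (A @ a # b # B) S = A @ glue a S @ (b + 1) # B"
  using assms by (subst qcomp_inner) (auto simp: glue_def nth_append)

lemma qcomp_wrap: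
  assumes "2 \<le> length S"
  shows "qcomp (Suc (Suc (length A))) (b # A @ [a]) S = (b + 1) # A @ glue a S"
  using assms by (subst qcomp_outer) (auto simp: glue_def)

text \<open>\<open>P\<close>, \<open>a\<close> and \<open>Q\<close> serve all \<open>S\<close> at
  once, so that two insertions at the same place can be compared in one frame.\<close>

lemma qcomp_context:
  assumes "2 \<le> length T" "1 \<le> i" "i \<le> length T"
  obtains P a Q where "length P = i - 1" "\<And>S. 2 \<le> length S \<Longrightarrow> qcomp i T S = P @ glue a S @ Q"
proof (cases "i = length T")
  case True
  from ends_cases[OF assms(1)] obtain b A a where "T = b # A @ [a]" .
  with True show ?thesis
    using that[of "(b + 1) # A" a "[]"] qcomp_wrap[of _ A b a] by simp
next
  case False
  with assms obtain A a b B where "T = A @ a # b # B" "i = Suc (length A)"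
    by (metis adjacent_cases le_neq_implies_less)
  then show ?thesis
    using that[of A a "(b + 1) # B"] qcomp_append by simp
qed

text \<open>\<open>glue\<close> only adds constants to the first and the last entry, which does not
  interfere with raising two adjacent entries and putting \<open>M\<close> between them. If
  \<open>A\<close> or \<open>B\<close> is empty, \<open>c'\<close> or \<open>d'\<close> absorbs the
  constant.\<close>

lemma glue_context:
  obtains P c' d' Q where "length P = length A"
    "\<And>u M v. glue a (A @ (c + u) # M @ (d + v) # B) = P @ (c' + u) # M @ (d' + v) # Q"
proof (cases A; cases B rule: rev_cases)
  assume "A = []" "B = []"
  then show ?thesis
    using that[of "[]" "a + c + 1" "d + 1" "[]"] by (simp add: glue_def)
next
  fix B' s' assume "A = []" "B = B' @ [s']"
  then show ?thesis
    using that[of "[]" "a + c + 1" "d" "B' @ [s' + 1]"] by (simp add: glue_def butlast_append)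
next
  fix s A' assume "A = s # A'" "B = []"
  then show ?thesis
    using that[of "(a + s + 1) # A'" "c" "d + 1" "[]"] by (simp add: glue_def butlast_append)
next
  fix s A' B' s' assume "A = s # A'" "B = B' @ [s']"
  then show ?thesis
    using that[of "(a + s + 1) # A'" "c" "d" "B' @ [s' + 1]"] by (simp add: glue_def butlast_append)
qed

text \<open>As \<open>j < length y\<close>, inserting \<open>z\<close> alters \<open>y\<close> only
  around two adjacent entries, which is compatible with \<open>glue\<close>. For
  \<open>j = length y\<close> it would raise the head of \<open>y\<close> instead of the entry of
  \<open>x\<close> after the block.\<close>

lemma qcomp_assoc:
  assumes "2 \<le> length x" "2 \<le> length z" "1 \<le> i" "i \<le> length x" "1 \<le> j" "j < length y"
  shows "qcomp (i + j - 1) (qcomp i x y) z = qcomp i x (qcomp j y z)"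
proof -
  obtain P a Q where P: "length P = i - 1" and x: "\<And>S. 2 \<le> length S \<Longrightarrow> qcomp i x S = P @ glue a S @ Q"
    using assms qcomp_context by metis
  obtain A c d B where y: "y = A @ c # d # B" and j: "j = Suc (length A)"
    using assms adjacent_cases by metis
  obtain P' c' d' Q' where P': "length P' = length A"
    and glue: "\<And>u M v. glue a (A @ (c + u) # M @ (d + v) # B) = P' @ (c' + u) # M @ (d' + v) # Q'"
    using glue_context by metis
  obtain s M s' where z: "z = s # M @ [s']"
    using assms ends_cases by metis
  have "i + j - 1 = Suc (length (P @ P'))"
    using P P' j assms by simp
  \<comment> \<open>Here \<open>glue\<close> is used with zero increments and empty
    \<open>M\<close>; below, \<open>z\<close> contributes the increments \<open>s + 1\<close> and
    \<open>1\<close>.\<close>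
  moreover have "qcomp i x y = (P @ P') @ c' # d' # Q' @ Q"
    using x[of y] glue[of 0 "[]" 0] y by simp
  ultimately have "qcomp (i + j - 1) (qcomp i x y) z = (P @ P') @ glue c' z @ (d' + 1) # Q' @ Q"
    using qcomp_append assms by presburger
  also have "\<dots> = P @ glue a (A @ (c + (s + 1)) # (M @ [s' + 1]) @ (d + 1) # B) @ Q"
    by (subst glue) (simp add: z)
  also have "A @ (c + (s + 1)) # (M @ [s' + 1]) @ (d + 1) # B = qcomp j y z"
    using assms by (simp add: y j qcomp_append) (simp add: z)
  also have "P @ glue a (qcomp j y z) @ Q = qcomp i x (qcomp j y z)"
    using assms by (simp add: x length_qcomp)
  finally show ?thesis .
qed

text \<open>Increments and insertions at different places do not depend on the order. The case split
  locates the entries affected by both \<open>y\<close> and \<open>z\<close>.\<close>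

lemma qcomp_commute:
  assumes "2 \<le> length y" "2 \<le> length z" "1 \<le> i" "i < j" "j \<le> length x"
  shows "qcomp (j + length y - 1) (qcomp i x y) z = qcomp i (qcomp j x z) y"
proof -
  obtain A a b B where x: "x = A @ a # b # B" and i: "i = Suc (length A)"
    using assms adjacent_cases[of i x] by (metis less_le_trans)
  obtain s M s' where y: "y = s # M @ [s']"
    using assms ends_cases by metis
  obtain t N t' where z: "z = t # N @ [t']"
    using assms ends_cases by metis
  have xy: "qcomp i x y = A @ (a + s + 1) # M @ (s' + 1) # (b + 1) # B"
    using assms by (simp add: x i qcomp_append) (simp add: y)
  show ?thesis
  proof (cases "j = length x")
    case False
    have "1 \<le> j - i" "j - i < length (b # B)"
      using assms False by (auto simp: x i)
    then obtain C c d D where bB: "b # B = C @ c # d # D" and j: "j - i = Suc (length C)"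
      by (metis adjacent_cases)
    show ?thesis
    proof (cases C)
      \<comment> \<open>Now \<open>j = i + 1\<close>: the entry \<open>b\<close> is raised by
        \<open>y\<close> and is also where \<open>z\<close> goes in.\<close>
      case Nil
      have "j = Suc (length (A @ [a]))" using j Nil i assms by simp
      moreover have "j + length y - 1 = Suc (length (A @ (a + s + 1) # M @ [s' + 1]))"
        using j Nil i assms y by simp
      ultimately show ?thesis
        using xy qcomp_append[OF assms(2), of "A @ [a]" c d D] bB Nil
          qcomp_append[OF assms(2), of "A @ (a + s + 1) # M @ [s' + 1]" "c + 1" d D]
          qcomp_append[OF assms(1), of A a "c + t + 1" "N @ (t' + 1) # (d + 1) # D"]
        by (simp add: x i) (simp add: y z add_ac)
    next
      case (Cons e C')
      have "j = Suc (length (A @ a # b # C'))" using j Cons i assms bB by simp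
      moreover have "j + length y - 1 = Suc (length (A @ (a + s + 1) # M @ (s' + 1) # (b + 1) # C'))"
        using j Cons i assms y by simp
      ultimately show ?thesis
        using xy qcomp_append[OF assms(2), of "A @ a # b # C'" c d D] bB Cons
          qcomp_append[OF assms(2), of "A @ (a + s + 1) # M @ (s' + 1) # (b + 1) # C'" "c" d D]
          qcomp_append[OF assms(1), of A a b "C' @ (c + t + 1) # N @ (t' + 1) # (d + 1) # D"]
        by (simp add: x i) (simp add: y z add_ac)
    qed
  next
    case True
    \<comment> \<open>\<open>z\<close> wraps around and raises the first entry, which is
      \<open>a\<close> if \<open>A\<close> is empty; it goes in at the last one, which is
      \<open>b\<close> if \<open>B\<close> is empty.\<close>
    show ?thesis
    proof (cases A; cases B rule: rev_cases)
      assume AB: "A = []" "B = []"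
      show ?thesis
        using xy qcomp_wrap[OF assms(2), of "[]" a b] True AB
          qcomp_wrap[OF assms(2), of "M @ [s' + 1]" "a + s + 1" "b + 1"]
          qcomp_append[OF assms(1), of "[]" "a + 1" "b + t + 1" "N @ [t' + 1]"]
        by (simp add: x i) (simp add: y z add_ac)
    next
      fix B' c assume AB: "A = []" "B = B' @ [c]"
      show ?thesis
        using xy qcomp_wrap[OF assms(2), of "b # B'" a c] True AB
          qcomp_wrap[OF assms(2), of "M @ (s' + 1) # (b + 1) # B'" "a + s + 1" "c"]
          qcomp_append[OF assms(1), of "[]" "a + 1" "b" "B' @ (c + t + 1) # N @ [t' + 1]"]
        by (simp add: x i) (simp add: y z add_ac)
    next
      fix f A' assume AB: "A = f # A'" "B = []"
      show ?thesis
        using xy qcomp_wrap[OF assms(2), of "A' @ [a]" f b] True AB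
          qcomp_wrap[OF assms(2), of "A' @ (a + s + 1) # M @ [s' + 1]" f "b + 1"]
          qcomp_append[OF assms(1), of "(f + 1) # A'" a "b + t + 1" "N @ [t' + 1]"]
        by (simp add: x i) (simp add: y z add_ac)
    next
      fix f A' B' c assume AB: "A = f # A'" "B = B' @ [c]"
      show ?thesis
        using xy qcomp_wrap[OF assms(2), of "A' @ a # b # B'" f c] True AB
          qcomp_wrap[OF assms(2), of "A' @ (a + s + 1) # M @ (s' + 1) # (b + 1) # B'" f c]
          qcomp_append[OF assms(1), of "(f + 1) # A'" a b "B' @ (c + t + 1) # N @ [t' + 1]"]
        by (simp add: x i) (simp add: y z add_ac)
    qed
  qed
qed

section \<open>Lists built by attaching ears\<close>

text \<open>Excluding \<open>j = length T\<close> loses nothing, since every triangulation has an ear whose tip is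
  neither the first nor the last vertex. It keeps every ear within the range of the weakened
  associativity law.\<close>

inductive ear_built :: "nat list \<Rightarrow> bool" where
  base: "ear_built [0, 0]"
| step: "ear_built T \<Longrightarrow> 1 \<le> j \<Longrightarrow> j < length T \<Longrightarrow> ear_built (qcomp j T [0, 0])"

lemma ear_built_length: "ear_built T \<Longrightarrow> 2 \<le> length T"
  by (induction rule: ear_built.induct) (auto simp: length_qcomp)

text \<open>An ear at the last index commutes with the ear attached before it; on
  \<open>[0, 0]\<close> both indices give \<open>[1, 1, 1]\<close>.\<close>

lemma ear_built_last_ear: "ear_built T \<Longrightarrow> ear_built (qcomp (length T) T [0, 0])"
proof (induction rule: ear_built.induct)
  case base
  show ?case
    using ear_built.step[OF ear_built.base, of 1] by (simp add: qcomp_def)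
next
  case (step T j)
  have T: "2 \<le> length T"
    using step ear_built_length by blast
  \<comment> \<open>\<open>length T + 2 - 1\<close> is the last index of the longer list
    \<open>qcomp j T [0, 0]\<close>.\<close>
  have "qcomp (length T + 2 - 1) (qcomp j T [0, 0]) [0, 0] = qcomp j (qcomp (length T) T [0, 0]) [0, 0]"
    using qcomp_commute[of "[0, 0]" "[0, 0]" j "length T" T] step by simp
  moreover have "ear_built (qcomp j (qcomp (length T) T [0, 0]) [0, 0])"
    by (rule ear_built.step) (use step T in \<open>auto simp: length_qcomp\<close>)
  ultimately show ?case
    using step T by (simp add: length_qcomp)
qed

lemma ear_built_qcomp:
  assumes "ear_built T" "1 \<le> i" "i \<le> length T" "ear_built S"
  shows "ear_built (qcomp i T S)"
  using assms(4)
proof (induction rule: ear_built.induct)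
  case base
  then show ?case
    using assms ear_built_last_ear ear_built.step by (cases "i = length T") auto
next
  case (step S j)
  have "2 \<le> length T" "2 \<le> length S"
    using assms(1) step(1) ear_built_length by auto
  \<comment> \<open>\<open>j < length S\<close> puts \<open>i + j - 1\<close> strictly below the
    length of \<open>qcomp i T S\<close>, as the rule demands.\<close>
  moreover from this have "ear_built (qcomp (i + j - 1) (qcomp i T S) [0, 0])"
    using step assms by (intro ear_built.step) (auto simp: length_qcomp)
  ultimately show ?case
    using qcomp_assoc[of T "[0, 0]" i j S] step assms by simp
qed

section \<open>Maximal noncrossing sets of chords\<close>

text \<open>Chords are pairs \<open>(a, b)\<close> with \<open>a < b\<close>. They include the sides, which belong to every maximal
  set; in this way the 2-gon with its single chord fits in.\<close>

definition max_noncrossing :: "nat \<Rightarrow> (nat \<Rightarrow> nat \<Rightarrow> bool) \<Rightarrow> bool" where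
  "max_noncrossing n R \<longleftrightarrow>
     (\<forall>a b. R a b \<longrightarrow> 1 \<le> a \<and> a < b \<and> b \<le> n) \<and>
     (\<forall>a b c d. R a c \<and> R b d \<longrightarrow> \<not> (a < b \<and> b < c \<and> c < d)) \<and>
     (\<forall>a b. 1 \<le> a \<and> a < b \<and> b \<le> n \<and>
        (\<forall>c d. R c d \<longrightarrow> \<not> (a < c \<and> c < b \<and> b < d) \<and> \<not> (c < a \<and> a < d \<and> d < b)) \<longrightarrow> R a b)"

definition tri :: "(nat \<Rightarrow> nat \<Rightarrow> bool) \<Rightarrow> nat set set" where
  "tri R = {{a, b, c} | a b c. R a b \<and> R b c \<and> R a c}"

definition tri_counts :: "nat \<Rightarrow> (nat \<Rightarrow> nat \<Rightarrow> bool) \<Rightarrow> nat list" where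
  "tri_counts n R = map (\<lambda>i. card {t \<in> tri R. i \<in> t}) [1..<n + 1]"

context
  fixes n R
  assumes R: "max_noncrossing n R"
begin

lemma max_noncrossing_bounds: "R a b \<Longrightarrow> 1 \<le> a \<and> a < b \<and> b \<le> n"
  using R unfolding max_noncrossing_def by blast

lemma max_noncrossing_not_cross: "R a c \<Longrightarrow> R b d \<Longrightarrow> a < b \<Longrightarrow> b < c \<Longrightarrow> c \<ge> d"
  using R unfolding max_noncrossing_def not_less[symmetric] by blast

lemma max_noncrossing_maximal:
  "1 \<le> a \<Longrightarrow> a < b \<Longrightarrow> b \<le> n \<Longrightarrow>
    (\<And>c d. R c d \<Longrightarrow> \<not> (a < c \<and> c < b \<and> b < d) \<and> \<not> (c < a \<and> a < d \<and> d < b)) \<Longrightarrow> R a b"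
  using R unfolding max_noncrossing_def by blast

lemma max_noncrossing_step: "1 \<le> a \<Longrightarrow> a < n \<Longrightarrow> R a (Suc a)"
  by (rule max_noncrossing_maximal) auto

lemma max_noncrossing_outer: "2 \<le> n \<Longrightarrow> R 1 n"
  by (rule max_noncrossing_maximal) (auto dest: max_noncrossing_bounds)

text \<open>A shortest chord \<open>(a, a + l)\<close> with \<open>l \<ge> 2\<close> has \<open>l = 2\<close>: otherwise \<open>(a, a + 2)\<close> is crossed by some
  chord, which stays below \<open>(a, a + l)\<close> and thus is a shorter one.\<close>

lemma max_noncrossing_ear:
  assumes "3 \<le> n"
  obtains a where "1 \<le> a" "a + 2 \<le> n" "R a (a + 2)"
proof -
  let ?P = "\<lambda>l. 2 \<le> l \<and> (\<exists>a. R a (a + l))"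
  have "?P (n - 1)"
    using max_noncrossing_outer assms by (auto intro!: exI[of _ 1])
  then have L: "?P (LEAST l. ?P l)"
    by (rule LeastI)
  have least: "(LEAST l. ?P l) \<le> l" if "?P l" for l
    using that by (rule Least_le)
  define l where "l = (LEAST l. ?P l)"
  obtain a where l: "2 \<le> l" and a: "R a (a + l)"
    using L unfolding l_def by blast
  note bounds = max_noncrossing_bounds[OF a]
  have "l = 2"
  proof (rule ccontr)
    assume "l \<noteq> 2"
    then have l3: "2 < l"
      using l by simp
    then have "\<not> R a (a + 2)"
      using least[of 2] unfolding l_def by fastforce
    then obtain c d where cd: "R c d"
      and cross: "a < c \<and> c < a + 2 \<and> a + 2 < d \<or> c < a \<and> a < d \<and> d < a + 2"
      using max_noncrossing_maximal[of a "a + 2"] bounds l3 by fastforce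
    from cross show False
    proof
      assume *: "a < c \<and> c < a + 2 \<and> a + 2 < d"
      then have "d \<le> a + l"
        using max_noncrossing_not_cross[OF a cd] l3 by linarith
      moreover have "?P (d - c)"
        using * cd by (auto intro!: exI[of _ c])
      then have "l \<le> d - c"
        using least l_def by blast
      ultimately show False
        using * by linarith
    next
      assume *: "c < a \<and> a < d \<and> d < a + 2"
      then show False
        using max_noncrossing_not_cross[OF cd a] l3 by linarith
    qed
  qed
  then show ?thesis
    using that[of a] a bounds by auto
qed

lemma finite_tri: "finite (tri R)"
proof (rule finite_subset)
  show "tri R \<subseteq> Pow {1..n}"
    unfolding tri_def
    by (auto dest!: max_noncrossing_bounds)
qed simp

end

lemma max_noncrossing_2: "max_noncrossing 2 R \<longleftrightarrow> (\<forall>a b. R a b \<longleftrightarrow> a = 1 \<and> b = 2)"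
proof
  assume R: "max_noncrossing 2 R"
  have "a = 1 \<and> b = 2" if "R a b" for a b
    using max_noncrossing_bounds[OF R that] by auto
  then show "\<forall>a b. R a b \<longleftrightarrow> a = 1 \<and> b = 2"
    using max_noncrossing_outer[OF R] by blast
next
  assume *: "\<forall>a b. R a b \<longleftrightarrow> a = 1 \<and> b = 2"
  show "max_noncrossing 2 R"
    unfolding max_noncrossing_def by (simp add: *)
qed

section \<open>Attaching and cutting off an ear, with relabelling of the vertices\<close>

definition skip :: "nat \<Rightarrow> nat \<Rightarrow> nat" where
  "skip j k = (if k \<le> j then k else Suc k)"

lemma skip_less_iff [simp]: "skip j x < skip j y \<longleftrightarrow> x < y"
  by (auto simp: skip_def)

lemma skip_eq_iff [simp]: "skip j x = skip j y \<longleftrightarrow> x = y"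
  by (auto simp: skip_def)

lemma skip_neq [simp]: "skip j x \<noteq> Suc j" "Suc j \<noteq> skip j x"
  by (auto simp: skip_def)

lemma skip_surj: "k \<noteq> Suc j \<Longrightarrow> \<exists>x. k = skip j x"
  by (rule exI[of _ "if k \<le> j then k else k - 1"]) (auto simp: skip_def)

text \<open>\<open>R'\<close> arises from \<open>R\<close> by attaching an ear with tip \<open>j + 1\<close> to the chord \<open>(j, j + 1)\<close>.\<close>

definition ear_extension :: "nat \<Rightarrow> (nat \<Rightarrow> nat \<Rightarrow> bool) \<Rightarrow> (nat \<Rightarrow> nat \<Rightarrow> bool) \<Rightarrow> bool" where
  "ear_extension j R R' \<longleftrightarrow>
     (\<forall>x y. R' (skip j x) (skip j y) \<longleftrightarrow> R x y) \<and>
     (\<forall>x. R' x (Suc j) \<longleftrightarrow> x = j) \<and> (\<forall>y. R' (Suc j) y \<longleftrightarrow> y = Suc (Suc j))"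

lemma ear_extension_iff:
  assumes "ear_extension j R R'"
  shows "R' a b \<longleftrightarrow> (\<exists>x y. a = skip j x \<and> b = skip j y \<and> R x y) \<or> a = j \<and> b = Suc j \<or>
    a = Suc j \<and> b = Suc (Suc j)"
proof (cases "a = Suc j \<or> b = Suc j")
  case True
  then show ?thesis
    using assms by (auto simp: ear_extension_def)
next
  case False
  then obtain x y where "a = skip j x" "b = skip j y"
    using skip_surj[of a j] skip_surj[of b j] by blast
  then show ?thesis
    using assms by (auto simp: ear_extension_def)
qed

lemma skip_bounds:
  assumes "1 \<le> j" "j < n"
  shows "1 \<le> skip j x \<longleftrightarrow> 1 \<le> x" "Suc 0 \<le> skip j x \<longleftrightarrow> Suc 0 \<le> x" "skip j x \<le> Suc n \<longleftrightarrow> x \<le> n"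
  using assms by (auto simp: skip_def)

text \<open>The two chords at the tip are sides of the larger polygon and cross nothing. Any other
  chord at the tip would cross \<open>(j, j + 2)\<close>, and chords avoiding the tip are relabelled
  old ones.\<close>

lemma max_noncrossing_extend:
  assumes ext: "ear_extension j R R'" and j: "1 \<le> j" "j < n" and R: "max_noncrossing n R"
  shows "max_noncrossing (Suc n) R'"
proof -
  note iff = ear_extension_iff[OF ext]
  have "R j (Suc j)"
    using max_noncrossing_step[OF R] j by simp
  \<comment> \<open>The former side \<open>(j, j + 1)\<close> becomes the base of the ear.\<close>
  then have chord: "R' j (Suc (Suc j))"
    unfolding iff by (intro disjI1 exI[of _ j] exI[of _ "Suc j"]) (simp add: skip_def)
  show ?thesis
    unfolding max_noncrossing_def
  proof (intro conjI allI impI)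
    fix a b assume "R' a b"
    then show "1 \<le> a" "a < b" "b \<le> Suc n"
      using j unfolding iff by (auto dest: max_noncrossing_bounds[OF R] simp: skip_bounds[OF j])
  next
    fix a b c d assume *: "R' a c \<and> R' b d"
    show "\<not> (a < b \<and> b < c \<and> c < d)"
    proof
      assume less: "a < b \<and> b < c \<and> c < d"
      then have "\<not> (a = j \<and> c = Suc j)" "\<not> (a = Suc j \<and> c = Suc (Suc j))"
        "\<not> (b = j \<and> d = Suc j)" "\<not> (b = Suc j \<and> d = Suc (Suc j))"
        by auto
      then obtain x y z w where "a = skip j x" "c = skip j y" "R x y" "b = skip j z" "d = skip j w" "R z w"
        using * unfolding iff by blast
      then show False
        using less max_noncrossing_not_cross[OF R, of x y z w] by simp
    qed
  next
    fix a b
    assume *: "1 \<le> a \<and> a < b \<and> b \<le> Suc n \<and>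
      (\<forall>c d. R' c d \<longrightarrow> \<not> (a < c \<and> c < b \<and> b < d) \<and> \<not> (c < a \<and> a < d \<and> d < b))"
    show "R' a b"
    proof (cases "a = Suc j \<or> b = Suc j")
      case True
      then have "a = j \<and> b = Suc j \<or> a = Suc j \<and> b = Suc (Suc j)"
        using * chord by (metis lessI less_SucE linorder_neqE_nat not_less_eq)
      then show ?thesis
        unfolding iff by blast
    next
      case False
      then obtain x y where xy: "a = skip j x" "b = skip j y"
        using skip_surj[of a j] skip_surj[of b j] by blast
      have "R x y"
      proof (rule max_noncrossing_maximal[OF R])
        show "1 \<le> x" "x < y" "y \<le> n"
          using * xy by (auto simp: skip_bounds[OF j])
        fix c d assume "R c d"
        then have "R' (skip j c) (skip j d)"
          unfolding iff by blast
        then show "\<not> (x < c \<and> c < y \<and> y < d) \<and> \<not> (c < x \<and> x < d \<and> d < y)"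
          using * xy skip_less_iff by metis
      qed
      then show ?thesis
        unfolding iff using xy by blast
    qed
  qed
qed

text \<open>The chord \<open>(j, j + 2)\<close> leaves the tip only its two sides. As these cross
  nothing, a chord that crosses none of \<open>R\<close> crosses none of \<open>R'\<close> after
  relabelling.\<close>

lemma max_noncrossing_restrict:
  assumes R': "max_noncrossing (Suc n) R'" and chord: "R' j (Suc (Suc j))" and j: "1 \<le> j" "j < n"
  obtains R where "ear_extension j R R'" "max_noncrossing n R"
proof
  define R where "R = (\<lambda>x y. R' (skip j x) (skip j y))"
  have left: "R' x (Suc j) \<longleftrightarrow> x = j" for x
    using max_noncrossing_not_cross[OF R' _ chord, of x "Suc j"] max_noncrossing_step[OF R' j(1)]
      max_noncrossing_bounds[OF R', of x "Suc j"] j by (auto simp: not_less_eq less_Suc_eq)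
  have right: "R' (Suc j) y \<longleftrightarrow> y = Suc (Suc j)" for y
    using max_noncrossing_not_cross[OF R' chord, of "Suc j" y] max_noncrossing_step[OF R', of "Suc j"]
      max_noncrossing_bounds[OF R', of "Suc j" y] j by (auto simp: le_less Suc_le_eq)
  show ext: "ear_extension j R R'"
    unfolding ear_extension_def R_def using left right by blast
  note iff = ear_extension_iff[OF ext]
  show "max_noncrossing n R"
    unfolding max_noncrossing_def
  proof (intro conjI allI impI)
    fix a b assume "R a b"
    then show "1 \<le> a" "a < b" "b \<le> n"
      using max_noncrossing_bounds[OF R'] unfolding R_def
      by (metis skip_bounds[OF j] skip_less_iff)+
  next
    fix a b c d assume "R a c \<and> R b d"
    then show "\<not> (a < b \<and> b < c \<and> c < d)"
      using max_noncrossing_not_cross[OF R'] unfolding R_def by (metis leD skip_less_iff)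
  next
    fix a b
    assume *: "1 \<le> a \<and> a < b \<and> b \<le> n \<and>
      (\<forall>c d. R c d \<longrightarrow> \<not> (a < c \<and> c < b \<and> b < d) \<and> \<not> (c < a \<and> a < d \<and> d < b))"
    show "R a b"
      unfolding R_def
    proof (rule max_noncrossing_maximal[OF R'])
      show "1 \<le> skip j a" "skip j a < skip j b" "skip j b \<le> Suc n"
        using * by (auto simp: skip_bounds[OF j])
      fix c d assume "R' c d"
      then show "\<not> (skip j a < c \<and> c < skip j b \<and> skip j b < d) \<and>
          \<not> (c < skip j a \<and> skip j a < d \<and> d < skip j b)"
        unfolding iff using * by (elim disjE exE conjE) auto
    qed
  qed
qed

text \<open>Only two chords end at the tip, so the ear is the only triangle there; the triangles
  without the tip are relabelled old ones.\<close>

lemma tri_extend: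
  assumes ext: "ear_extension j R R'" and j: "1 \<le> j" "j < n" and R: "max_noncrossing n R"
  shows "tri R' = insert {j, Suc j, Suc (Suc j)} ((`) (skip j) ` tri R)"
proof (rule set_eqI, rule iffI)
  note iff = ear_extension_iff[OF ext]
  have e: "R' (skip j x) (skip j y) \<longleftrightarrow> R x y" "R' x (Suc j) \<longleftrightarrow> x = j" "R' (Suc j) y \<longleftrightarrow> y = Suc (Suc j)" for x y
    using ext by (auto simp: ear_extension_def)
  have irr: "\<not> R' x x" for x
    using max_noncrossing_bounds[OF max_noncrossing_extend[OF ext j R], of x x] by auto
  fix t
  {
    assume "t \<in> tri R'"
    then obtain a b c where t: "t = {a, b, c}" and abc: "R' a b" "R' b c" "R' a c"
      by (auto simp: tri_def)
    show "t \<in> insert {j, Suc j, Suc (Suc j)} ((`) (skip j) ` tri R)"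
    proof (cases "a = Suc j \<or> b = Suc j \<or> c = Suc j")
      \<comment> \<open>The tip is the middle vertex: as the smallest or the largest it would force
        the other two to coincide, against \<open>irr\<close>.\<close>
      case True
      then show ?thesis
        using abc irr t by (auto simp: e)
    next
      case False
      then obtain x y z where xyz: "a = skip j x" "b = skip j y" "c = skip j z"
        using skip_surj[of a j] skip_surj[of b j] skip_surj[of c j] by blast
      then have "{x, y, z} \<in> tri R" "t = skip j ` {x, y, z}"
        using abc e t by (auto simp: tri_def)
      then show ?thesis
        by blast
    qed
  }
  assume "t \<in> insert {j, Suc j, Suc (Suc j)} ((`) (skip j) ` tri R)"
  then consider "t = {j, Suc j, Suc (Suc j)}" | u where "u \<in> tri R" "t = skip j ` u"
    by blast
  then show "t \<in> tri R'"
  proof cases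
    case 1
    have "R' j (Suc (Suc j))"
      using e(1)[of j "Suc j"] max_noncrossing_step[OF R] j by (simp add: skip_def)
    then show ?thesis
      using 1 e unfolding tri_def by blast
  next
    case 2
    then obtain x y z where "t = {skip j x, skip j y, skip j z}" "R x y" "R y z" "R x z"
      by (auto simp: tri_def)
    then show ?thesis
      using e(1) unfolding tri_def by blast
  qed
qed

text \<open>The ear is the one new triangle, with base at the old vertices \<open>j\<close> and
  \<open>j + 1\<close>. It differs from all relabelled triangles, which miss the tip.\<close>

lemma card_tri_skip:
  assumes ext: "ear_extension j R R'" and j: "1 \<le> j" "j < n" and R: "max_noncrossing n R"
  shows "card {t \<in> tri R'. skip j k \<in> t} =
    card {t \<in> tri R. k \<in> t} + (if k = j \<or> k = Suc j then 1 else 0)"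
proof -
  define E where "E = {j, Suc j, Suc (Suc j)}"
  define U where "U = {t \<in> tri R. k \<in> t}"
  have inj: "inj (skip j)"
    by (simp add: inj_def)
  have mem: "skip j k \<in> E \<longleftrightarrow> k = j \<or> k = Suc j"
    by (auto simp: skip_def E_def)
  have E: "E \<noteq> skip j ` u" for u
  proof
    assume "E = skip j ` u"
    moreover have "Suc j \<in> E"
      by (simp add: E_def)
    ultimately show False
      by auto
  qed
  have "finite U"
    using finite_tri[OF R] by (simp add: U_def)
  have "{t \<in> tri R'. skip j k \<in> t} = (if skip j k \<in> E then {E} else {}) \<union> (`) (skip j) ` U"
    unfolding tri_extend[OF ext j R] E_def[symmetric] U_def
    by (auto simp: inj_image_mem_iff[OF inj])
  also have "card \<dots> = card (if skip j k \<in> E then {E} else {}) + card ((`) (skip j) ` U)"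
    using E \<open>finite U\<close> by (intro card_Un_disjoint) auto
  also have "card ((`) (skip j) ` U) = card U"
    by (rule card_image) (simp add: inj_on_def inj_image_eq_iff[OF inj])
  finally show ?thesis
    unfolding U_def[symmetric] by (simp add: mem)
qed

lemma card_tri_tip:
  assumes ext: "ear_extension j R R'" and j: "1 \<le> j" "j < n" and R: "max_noncrossing n R"
  shows "card {t \<in> tri R'. Suc j \<in> t} = 1"
proof -
  have "{t \<in> tri R'. Suc j \<in> t} = {{j, Suc j, Suc (Suc j)}}"
    unfolding tri_extend[OF ext j R] by auto
  then show ?thesis
    by simp
qed

section \<open>Triangle counts and ears\<close>

lemma nth_tri_counts: "k < n \<Longrightarrow> tri_counts n R ! k = card {t \<in> tri R. Suc k \<in> t}"
  by (simp add: tri_counts_def nth_upt del: upt_Suc)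

lemma length_tri_counts [simp]: "length (tri_counts n R) = n"
  by (simp add: tri_counts_def)

lemma tri_counts_extend:
  assumes ext: "ear_extension j R R'" and j: "1 \<le> j" "j < n" and R: "max_noncrossing n R"
  shows "tri_counts (Suc n) R' = qcomp j (tri_counts n R) [0, 0]"
proof (rule nth_equalityI)
  let ?T = "tri_counts n R"
  have T: "qcomp j ?T [0, 0] = take (j - 1) ?T @ [?T ! (j - 1) + 1, 1, ?T ! j + 1] @ drop (j + 1) ?T"
    using j by (subst qcomp_inner) auto
  show "length (tri_counts (Suc n) R') = length (qcomp j ?T [0, 0])"
    using j by (simp add: T)
  fix k assume "k < length (tri_counts (Suc n) R')"
  then have k: "k < Suc n"
    by simp
  \<comment> \<open>Position \<open>k\<close> belongs to vertex \<open>k + 1\<close>: positions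
    below \<open>j\<close> keep their vertex, position \<open>j\<close> is the tip, and the later
    vertices are shifted by one.\<close>
  consider "k < j" | "k = j" | l where "k = Suc l" "j \<le> l"
    by (metis Suc_le_D Suc_le_eq Suc_le_mono linorder_neqE_nat)
  then show "tri_counts (Suc n) R' ! k = qcomp j ?T [0, 0] ! k"
  proof cases
    case 1
    then have "Suc k = skip j (Suc k)"
      by (simp add: skip_def)
    then have "tri_counts (Suc n) R' ! k = ?T ! k + (if Suc k = j then 1 else 0)"
      using card_tri_skip[OF ext j R, of "Suc k"] 1 j k by (simp add: nth_tri_counts)
    then show ?thesis
      unfolding T using 1 j by (auto simp: nth_append nth_Cons')
  next
    case 2
    then show ?thesis
      unfolding T using j card_tri_tip[OF ext j R] by (auto simp: nth_tri_counts nth_append)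
  next
    case 3
    then have "Suc k = skip j (Suc l)"
      by (simp add: skip_def)
    then have "tri_counts (Suc n) R' ! k = ?T ! l + (if l = j then 1 else 0)"
      using card_tri_skip[OF ext j R, of "Suc l"] 3 k by (simp add: nth_tri_counts)
    then show ?thesis
      unfolding T using 3 j k by (auto simp: nth_append nth_Cons')
  qed
qed

lemma ear_extension_exists: "\<exists>R'. ear_extension j R R'"
proof
  show "ear_extension j R (\<lambda>a b. (\<exists>x y. a = skip j x \<and> b = skip j y \<and> R x y) \<or>
      a = j \<and> b = Suc j \<or> a = Suc j \<and> b = Suc (Suc j))"
    unfolding ear_extension_def by auto
qed

lemma ear_built_imp_tri_counts:
  "ear_built T \<Longrightarrow> \<exists>R. max_noncrossing (length T) R \<and> T = tri_counts (length T) R"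
proof (induction rule: ear_built.induct)
  case base
  let ?R = "\<lambda>a b :: nat. a = 1 \<and> b = 2"
  have "tri ?R = {}"
    by (auto simp: tri_def)
  then have "tri_counts 2 ?R = [0, 0]"
    by (simp add: tri_counts_def upt_rec)
  moreover have "max_noncrossing 2 ?R"
    by (simp add: max_noncrossing_2)
  ultimately show ?case
    by (intro exI[of _ ?R]) (simp add: numeral_2_eq_2)
next
  case (step T j)
  then obtain R where R: "max_noncrossing (length T) R" "T = tri_counts (length T) R"
    by blast
  obtain R' where ext: "ear_extension j R R'"
    using ear_extension_exists by blast
  have "length (qcomp j T [0, 0]) = Suc (length T)"
    using step ear_built_length[of T] by (simp add: length_qcomp)
  then show ?case
    using max_noncrossing_extend[OF ext step(2,3) R(1)] tri_counts_extend[OF ext step(2,3) R(1)] R(2)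
    by metis
qed

text \<open>Induction by cutting off the ear from \<open>max_noncrossing_ear\<close>. Its base
  \<open>(a, a + 2)\<close> fits into \<open>Suc n\<close> labels, so \<open>a < n\<close>, as
  \<open>ear_built.step\<close> requires.\<close>

lemma ear_built_tri_counts:
  assumes "2 \<le> n" "max_noncrossing n R"
  shows "ear_built (tri_counts n R)"
  using assms
proof (induction n arbitrary: R rule: nat_induct_at_least)
  case base
  then have "tri R = {}"
    by (auto simp: max_noncrossing_2 tri_def)
  then have "tri_counts 2 R = [0, 0]"
    by (simp add: tri_counts_def upt_rec)
  then show ?case
    using ear_built.base by simp
next
  case (Suc n)
  then obtain a where a: "1 \<le> a" "a + 2 \<le> Suc n" "R a (Suc (Suc a))"
    using max_noncrossing_ear[of "Suc n" R] by auto
  then obtain Q where Q: "ear_extension a Q R" "max_noncrossing n Q"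
    using max_noncrossing_restrict[OF Suc.prems a(3)] by auto
  then have "tri_counts (Suc n) R = qcomp a (tri_counts n Q) [0, 0]"
    using tri_counts_extend a by simp
  then show ?case
    using ear_built.step[of "tri_counts n Q" a] Suc.IH[OF Q(2)] a by simp
qed

section \<open>Triangulations as maximal noncrossing sets of chords\<close>

definition chord_rel :: "nat \<Rightarrow> nat set set \<Rightarrow> nat \<Rightarrow> nat \<Rightarrow> bool" where
  "chord_rel n D a b \<longleftrightarrow> a < b \<and> {a, b} \<in> sides n \<union> D"

lemma doubleton_in_sides:
  assumes "a < b" "3 \<le> n"
  shows "{a, b} \<in> sides n \<longleftrightarrow> 1 \<le> a \<and> b = Suc a \<and> b \<le> n \<or> a = 1 \<and> b = n"
  using assms by (auto simp: sides_def doubleton_eq_iff)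

lemma doubleton_in_diagonals:
  assumes "a < b"
  shows "{a, b} \<in> diagonals n \<longleftrightarrow> 1 \<le> a \<and> b \<le> n \<and> {a, b} \<notin> sides n"
proof
  assume "{a, b} \<in> diagonals n"
  then show "1 \<le> a \<and> b \<le> n \<and> {a, b} \<notin> sides n"
    by (auto simp: diagonals_def doubleton_eq_iff)
next
  assume "1 \<le> a \<and> b \<le> n \<and> {a, b} \<notin> sides n"
  moreover from this have "a \<in> {1..n}" "b \<in> {1..n}" "a \<noteq> b"
    using assms by auto
  ultimately show "{a, b} \<in> diagonals n"
    unfolding diagonals_def by blast
qed

lemma diagonals_cases:
  assumes "d \<in> diagonals n"
  obtains a b where "d = {a, b}" "1 \<le> a" "a < b" "b \<le> n"
proof -
  from assms obtain i j where ij: "d = {i, j}" "i \<in> {1..n}" "j \<in> {1..n}" "i \<noteq> j"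
    by (auto simp: diagonals_def)
  then show ?thesis
    using that[of i j] that[of j i] by (cases "i < j") (auto simp: insert_commute)
qed

lemma chord_rel_bounds:
  assumes "3 \<le> n" "D \<subseteq> diagonals n" "chord_rel n D a b"
  shows "1 \<le> a \<and> a < b \<and> b \<le> n"
  using assms doubleton_in_diagonals[of a b n] doubleton_in_sides[of a b n]
  unfolding chord_rel_def by auto

text \<open>By \<open>crossing_iff\<close>, distinct chords cross when their labels interleave.
  Sides interleave with no chord, so adding them affects neither noncrossing nor maximality.\<close>

lemma max_noncrossing_chord_rel:
  assumes p: "convex_ngon n p" and D: "triangulation n p D"
  shows "max_noncrossing n (chord_rel n D)"
proof -
  have n: "3 \<le> n"
    using p by (simp add: convex_ngon_def)
  have diag: "D \<subseteq> diagonals n" and noncr: "\<And>d e. d \<in> D \<Longrightarrow> e \<in> D \<Longrightarrow> d \<noteq> e \<Longrightarrow> \<not> crossing p d e"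
    and maxi: "\<And>d. d \<in> diagonals n \<Longrightarrow> (\<And>e. e \<in> D \<Longrightarrow> \<not> crossing p d e) \<Longrightarrow> d \<in> D"
    using D unfolding triangulation_def by blast+
  note bounds = chord_rel_bounds[OF n diag]
  show ?thesis
    unfolding max_noncrossing_def
  proof (intro conjI allI impI)
    fix a b assume "chord_rel n D a b"
    then show "1 \<le> a" "a < b" "b \<le> n"
      using bounds by auto
  next
    fix a b c d assume *: "chord_rel n D a c \<and> chord_rel n D b d"
    show "\<not> (a < b \<and> b < c \<and> c < d)"
    proof
      assume less: "a < b \<and> b < c \<and> c < d"
      note bd = bounds[of a c] bounds[of b d]
      have "{a, c} \<notin> sides n" "{b, d} \<notin> sides n"
        using less bd * doubleton_in_sides[of a c n] doubleton_in_sides[of b d n] n by auto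
      then have "{a, c} \<in> D" "{b, d} \<in> D"
        using * by (auto simp: chord_rel_def)
      moreover have "{a, c} \<noteq> {b, d}"
        using less by (auto simp: doubleton_eq_iff)
      moreover have "crossing p {a, c} {b, d}"
        using crossing_iff[OF p, of a c b d] less bd * by auto
      ultimately show False
        using noncr by blast
    qed
  next
    fix a b
    assume *: "1 \<le> a \<and> a < b \<and> b \<le> n \<and> (\<forall>c d. chord_rel n D c d \<longrightarrow>
      \<not> (a < c \<and> c < b \<and> b < d) \<and> \<not> (c < a \<and> a < d \<and> d < b))"
    have "{a, b} \<in> D" if side: "{a, b} \<notin> sides n"
    proof (rule ccontr)
      assume notin: "{a, b} \<notin> D"
      have "{a, b} \<in> diagonals n"
        using * side by (simp add: doubleton_in_diagonals)
      then obtain e where e: "e \<in> D" "crossing p {a, b} e"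
        using maxi notin by blast
      then obtain c d where cd: "e = {c, d}" "1 \<le> c" "c < d" "d \<le> n"
        using diag diagonals_cases by blast
      then have "a \<noteq> c \<or> b \<noteq> d"
        using e notin by auto
      then have "a < c \<and> c < b \<and> b < d \<or> c < a \<and> a < d \<and> d < b"
        using crossing_iff[OF p, of a b c d] e cd * by simp
      moreover have "chord_rel n D c d"
        using e cd by (simp add: chord_rel_def)
      ultimately show False
        using * by blast
    qed
    then show "chord_rel n D a b"
      using * by (auto simp: chord_rel_def)
  qed
qed

text \<open>Removing the sides from \<open>R\<close> inverts \<open>chord_rel\<close>. Any convex
  polygon will do, as crossing depends only on the labels.\<close>

lemma triangulation_of_max_noncrossing:
  assumes p: "convex_ngon n p" and R: "max_noncrossing n R"
  obtains D where "triangulation n p D" "chord_rel n D = R"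
proof
  define D where "D = {{a, b} | a b. R a b} - sides n"
  have n: "3 \<le> n"
    using p by (simp add: convex_ngon_def)
  have in_D: "{a, b} \<in> D \<longleftrightarrow> R a b \<and> {a, b} \<notin> sides n" if "a < b" for a b
  proof -
    have "a' = a \<and> b' = b" if "R a' b'" "{a, b} = {a', b'}" for a' b'
      using max_noncrossing_bounds[OF R that(1)] that(2) \<open>a < b\<close> by (auto simp: doubleton_eq_iff)
    then have "{a, b} \<in> {{a, b} | a b. R a b} \<longleftrightarrow> R a b"
      by (smt (verit) mem_Collect_eq)
    then show ?thesis
      by (simp add: D_def)
  qed
  have D_cases: "\<exists>a b. d = {a, b} \<and> R a b \<and> {a, b} \<notin> sides n" if "d \<in> D" for d
    using that unfolding D_def by blast
  show "chord_rel n D = R"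
  proof (intro ext)
    fix a b
    have "R a b" if "a < b" "{a, b} \<in> sides n"
      using that n max_noncrossing_step[OF R] max_noncrossing_outer[OF R]
      by (auto simp: doubleton_in_sides)
    then show "chord_rel n D a b = R a b"
      using in_D max_noncrossing_bounds[OF R, of a b] unfolding chord_rel_def by blast
  qed
  show "triangulation n p D"
    unfolding triangulation_def
  proof (intro conjI ballI impI subsetI)
    fix d assume "d \<in> D"
    then show "d \<in> diagonals n"
      using D_cases max_noncrossing_bounds[OF R] doubleton_in_diagonals by metis
  next
    fix d e assume "d \<in> D" "e \<in> D" "d \<noteq> e"
    then obtain a b c f where ab: "d = {a, b}" "R a b" and cf: "e = {c, f}" "R c f" and ne: "a \<noteq> c \<or> b \<noteq> f"
      using D_cases by metis
    then show "\<not> crossing p d e"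
      using crossing_iff[OF p _ _ _ _ _ _ ne] max_noncrossing_bounds[OF R] max_noncrossing_not_cross[OF R]
      by (metis leD)
  next
    fix d assume d: "d \<in> diagonals n" and nc: "\<forall>e\<in>D. \<not> crossing p d e"
    obtain a b where ab: "d = {a, b}" "1 \<le> a" "a < b" "b \<le> n"
      using d diagonals_cases by blast
    have "R a b"
    proof (rule max_noncrossing_maximal[OF R ab(2-4)])
      fix c f assume cf: "R c f"
      note bd = max_noncrossing_bounds[OF R cf]
      show "\<not> (a < c \<and> c < b \<and> b < f) \<and> \<not> (c < a \<and> a < f \<and> f < b)"
      proof (rule ccontr)
        assume cross: "\<not> (\<not> (a < c \<and> c < b \<and> b < f) \<and> \<not> (c < a \<and> a < f \<and> f < b))"
        \<comment> \<open>A side interleaves with no chord, so the crossing chord is a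
          diagonal.\<close>
        then have "{c, f} \<notin> sides n"
          using bd n ab by (auto simp: doubleton_in_sides)
        then have "{c, f} \<in> D"
          using in_D bd cf by blast
        moreover have "crossing p d {c, f}"
          using crossing_iff[OF p, of a b c f] cross bd ab by auto
        ultimately show False
          using nc by blast
      qed
    qed
    then show "d \<in> D"
      using in_D[OF ab(3)] ab(1) d by (simp add: diagonals_def)
  qed
qed

lemma card_3_nat_cases:
  fixes t :: "nat set"
  assumes "card t = 3"
  obtains a b c where "t = {a, b, c}" "a < b" "b < c"
proof -
  obtain x y z where xyz: "t = {x, y, z}" "x \<noteq> y" "y \<noteq> z" "x \<noteq> z"
    using assms by (auto simp: card_3_iff)
  consider "x < y" "y < z" | "x < z" "z < y" | "y < x" "x < z" | "y < z" "z < x" | "z < x" "x < y"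
    | "z < y" "y < x"
    using xyz(2-4) by linarith
  then show ?thesis
    using that xyz(1) by cases (metis insert_commute)+
qed

text \<open>Sorting the vertices of an unordered triangle gives the increasing triple that
  \<open>tri\<close> uses.\<close>

lemma triangles_eq_tri:
  assumes n: "3 \<le> n" and D: "D \<subseteq> diagonals n"
  shows "triangles n D = tri (chord_rel n D)"
proof (intro set_eqI iffI)
  fix t assume "t \<in> triangles n D"
  then have t: "card t = 3" "\<And>i j. i \<in> t \<Longrightarrow> j \<in> t \<Longrightarrow> i \<noteq> j \<Longrightarrow> {i, j} \<in> sides n \<union> D"
    by (auto simp: triangles_def)
  obtain a b c where abc: "t = {a, b, c}" "a < b" "b < c"
    using card_3_nat_cases[OF t(1)] .
  then have "chord_rel n D a b" "chord_rel n D b c" "chord_rel n D a c"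
    unfolding chord_rel_def using t(2) by auto
  then show "t \<in> tri (chord_rel n D)"
    using abc unfolding tri_def by blast
next
  fix t assume "t \<in> tri (chord_rel n D)"
  then obtain a b c where t: "t = {a, b, c}"
    and abc: "chord_rel n D a b" "chord_rel n D b c" "chord_rel n D a c"
    by (auto simp: tri_def)
  note bd = abc[THEN chord_rel_bounds[OF n D]]
  have "card t = 3" "t \<subseteq> {1..n}"
    using t bd by auto
  moreover have "\<forall>i\<in>t. \<forall>j\<in>t. i \<noteq> j \<longrightarrow> {i, j} \<in> sides n \<union> D"
    using abc unfolding t chord_rel_def by (auto simp: insert_commute)
  ultimately show "t \<in> triangles n D"
    by (simp add: triangles_def)
qed

lemma quiddity_eq_tri_counts:
  assumes "3 \<le> n" "D \<subseteq> diagonals n"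
  shows "quiddity n D = tri_counts n (chord_rel n D)"
  using triangles_eq_tri[OF assms] by (simp add: quiddity_def tri_counts_def)

section \<open>Quiddity sequences as lists built by ears\<close>

lemma length_QS: "T \<in> QS n \<Longrightarrow> length T = n"
  by (auto simp: QS_def quiddity_def split: if_splits)

lemma ear_built_length_2:
  assumes "ear_built T" "length T = 2"
  shows "T = [0, 0]"
  using assms(1)
proof cases
  case (step S j)
  have "2 \<le> length S"
    using step(2) by (rule ear_built_length)
  then have "length T = Suc (length S)"
    unfolding step(1) using step(3,4) by (subst length_qcomp) auto
  then show ?thesis
    using assms(2) \<open>2 \<le> length S\<close> by simp
qed

lemma QS_eq_ear_built:
  assumes "2 \<le> n"
  shows "QS n = {T. ear_built T \<and> length T = n}"
proof (cases "n = 2")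
  case True
  have "{T. ear_built T \<and> length T = 2} = {[0, 0]}"
    by (auto intro: ear_built.base ear_built_length_2)
  then show ?thesis
    unfolding True QS_def by simp
next
  case False
  then have n: "3 \<le> n"
    using assms by simp
  then have QS: "QS n = {quiddity n D | p D. convex_ngon n p \<and> triangulation n p D}"
    by (simp add: QS_def)
  show ?thesis
  proof (intro set_eqI iffI)
    fix T assume T: "T \<in> QS n"
    then obtain p D where pD: "convex_ngon n p" "triangulation n p D" "T = quiddity n D"
      unfolding QS by blast
    then have "T = tri_counts n (chord_rel n D)"
      using quiddity_eq_tri_counts[OF n] by (simp add: triangulation_def)
    then show "T \<in> {T. ear_built T \<and> length T = n}"
      using ear_built_tri_counts[OF assms max_noncrossing_chord_rel[OF pD(1,2)]] length_QS[OF T] by simp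
  next
    fix T assume "T \<in> {T. ear_built T \<and> length T = n}"
    then obtain R where R: "max_noncrossing n R" "T = tri_counts n R"
      using ear_built_imp_tri_counts by blast
    \<comment> \<open>\<open>QS n\<close> ranges over all convex polygons, so one that realizes
      \<open>T\<close> is enough.\<close>
    obtain p where p: "convex_ngon n p"
      using convex_ngon_parabola[OF n] by blast
    obtain D where D: "triangulation n p D" "chord_rel n D = R"
      using triangulation_of_max_noncrossing[OF p R(1)] .
    then have "T = quiddity n D"
      using R quiddity_eq_tri_counts[OF n, of D] by (simp add: triangulation_def)
    then show "T \<in> QS n"
      unfolding QS using p D by blast
  qed
qed

section \<open>The operad axioms, with arity 1 treated separately\<close>

lemma QS_1: "QS 1 = {[0]}"
  by (simp add: QS_def)

lemma qcomp_unit_left: "qcomp i [0] S = S"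
  by (simp add: qcomp_def)

lemma qcomp_unit_right: "qcomp i T [0] = T"
  by (simp add: qcomp_def)

lemma QS_arity_cases:
  assumes "x \<in> QS n" "1 \<le> n"
  obtains "n = 1" "x = [0]" | "2 \<le> n" "ear_built x" "length x = n"
  using assms QS_eq_ear_built[of n] QS_1 by (cases "n = 1") auto

theorem theorem3:
  shows "quiddity_operad QS qcomp [0]"
proof
  fix n m :: nat assume "1 \<le> n" "1 \<le> m" "n \<noteq> m"
  then show "QS n \<inter> QS m = {}"
    using length_QS by blast
next
  fix n m i x y
  assume *: "1 \<le> n" "1 \<le> m" "i \<in> {1..n}" "x \<in> QS n" "y \<in> QS m"
  show "qcomp i x y \<in> QS (n + m - 1)"
  proof (cases rule: QS_arity_cases[OF *(4,1)]; cases rule: QS_arity_cases[OF *(5,2)])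
    assume xy: "2 \<le> n" "ear_built x" "length x = n" "2 \<le> m" "ear_built y" "length y = m"
    then show ?thesis
      using * ear_built_qcomp[of x i y] by (simp add: QS_eq_ear_built length_qcomp)
  qed (use * in \<open>auto simp: qcomp_unit_left qcomp_unit_right\<close>)
next
  show "[0] \<in> QS 1"
    unfolding QS_1 by simp
next
  fix n m k i j x y z
  assume *: "1 \<le> n" "2 \<le> m" "1 \<le> k" "x \<in> QS n" "y \<in> QS m" "z \<in> QS k" "i \<in> {1..n}" "j \<in> {1..m - 1}"
  show "qcomp (i + j - 1) (qcomp i x y) z = qcomp i x (qcomp j y z)"
  \<comment> \<open>As \<open>m\<close> is at least 2, only \<open>x\<close> and \<open>z\<close>
    can be the unit, and then both sides collapse to the same expression.\<close>
  proof (cases rule: QS_arity_cases[OF *(4,1)]; cases rule: QS_arity_cases[OF *(6,3)])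
    assume "2 \<le> n" "length x = n" "2 \<le> k" "length z = k"
    moreover have "1 \<le> i" "i \<le> n" "1 \<le> j" "j < length y"
      using * length_QS[OF *(5)] by auto
    ultimately show ?thesis
      using qcomp_assoc by simp
  qed (use * in \<open>auto simp: qcomp_unit_left qcomp_unit_right\<close>)
next
  fix n m k i j x y z
  assume *: "1 < n" "1 \<le> m" "1 \<le> k" "x \<in> QS n" "y \<in> QS m" "z \<in> QS k"
    "i \<in> {1..n}" "j \<in> {1..n}" "i < j"
  show "qcomp (j + m - 1) (qcomp i x y) z = qcomp i (qcomp j x z) y"
  \<comment> \<open>As \<open>n\<close> exceeds 1, only \<open>y\<close> and \<open>z\<close> can be
    the unit. For \<open>y = [0]\<close> the index \<open>j + m - 1\<close> is just
    \<open>j\<close>.\<close>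
  proof (cases rule: QS_arity_cases[OF *(5,2)]; cases rule: QS_arity_cases[OF *(6,3)])
    assume "2 \<le> m" "length y = m" "2 \<le> k" "length z = k"
    then show ?thesis
      using qcomp_commute[of y z i j x] * length_QS[OF *(4)] by simp
  qed (use * in \<open>auto simp: qcomp_unit_left qcomp_unit_right\<close>)
next
  fix n x assume "1 \<le> n" "x \<in> QS n"
  then show "qcomp 1 [0] x = x"
    by (simp add: qcomp_unit_left)
next
  fix n x i assume "1 \<le> n" "x \<in> QS n" "i \<in> {1..n}"
  then show "qcomp i x [0] = x"
    by (simp add: qcomp_unit_right)
qed

end
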